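(* Let $h\ge 1$ be an integer, assume $\boldsymbol{\gamma}_0$ and $\boldsymbol{\gamma}_h$ are linearly independent vectors in $\mathbb{R}^L$, and consider, for a real number $\alpha_0$, the optimization problem over $\mathbf{b}\in\mathbb{R}^L$ $$\max_{\mathbf{b}}\ \boldsymbol{\gamma}_h'\mathbf{b}\quad\text{subject to}\quad \frac{\boldsymbol{\gamma}_0'\mathbf{b}}{\|\boldsymbol{\gamma}_0\|}=\alpha_0,\qquad \mathbf{b}'\mathbf{b}=1 .$$ (1) If $|\alpha_0|<1$, then the solution lies in $\mathrm{span}\{\boldsymbol{\gamma}_0,\boldsymbol{\gamma}_h\}$, i.e. $\mathbf{b}=\lambda_1\boldsymbol{\gamma}_h+\lambda_2\boldsymbol{\gamma}_0$ for some scalars $\lambda_1,\lambda_2$, and moreover: (1a) If $\boldsymbol{\gamma}_0'\boldsymbol{\gamma}_h\neq 0$, then $$\lambda_1=\frac{\alpha_0\|\boldsymbol{\gamma}_0\|-\lambda_2\,\boldsymbol{\gamma}_0'\boldsymbol{\gamma}_0}{\boldsymbol{\gamma}_0'\boldsymbol{\gamma}_h},\qquad \lambda_2=\frac{-b\pm\sqrt{b^2-4ac}}{2a},$$ where $$a=\boldsymbol{\gamma}_0'\boldsymbol{\gamma}_0\left(\frac{\boldsymbol{\gamma}_0'\boldsymbol{\gamma}_0\,\boldsymbol{\gamma}_h'\boldsymbol{\gamma}_h}{(\boldsymbol{\gamma}_0'\boldsymbol{\gamma}_h)^2}-1\right),\quad b=2\alpha_0\|\boldsymbol{\gamma}_0\|\left(1-\frac{\boldsymbol{\gamma}_0'\boldsymbol{\gamma}_0\,\boldsymbol{\gamma}_h'\boldsymbol{\gamma}_h}{(\boldsymbol{\gamma}_0'\boldsymbol{\gamma}_h)^2}\right),\quad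 c=\frac{\alpha_0^2\,\boldsymbol{\gamma}_0'\boldsymbol{\gamma}_0\,\boldsymbol{\gamma}_h'\boldsymbol{\gamma}_h}{(\boldsymbol{\gamma}_0'\boldsymbol{\gamma}_h)^2}-1,$$ and, of the two candidate roots for $\lambda_2$, the solution is given by the one for which the objective $\boldsymbol{\gamma}_h'\mathbf{b}$ is larger. (1b) If $\boldsymbol{\gamma}_0'\boldsymbol{\gamma}_h=0$, then $$\lambda_2=\frac{\alpha_0}{\|\boldsymbol{\gamma}_0\|},\qquad \lambda_1=\pm\sqrt{\frac{1-\alpha_0^2}{\boldsymbol{\gamma}_h'\boldsymbol{\gamma}_h}},$$ where the sign is the one for which the objective $\boldsymbol{\gamma}_h'\mathbf{b}$ is larger. (2) If $|\alpha_0|=1$, then the solution is $\mathbf{b}=\mathrm{sign}(\alpha_0)\,\boldsymbol{\gamma}_0/\|\boldsymbol{\gamma}_0\|$.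
   Context: $(\gamma_k)_{k\in\mathbb{Z}}$ is a square-summable real sequence, $L\ge 1$ is an integer (filter length), and for each integer $h\ge 0$ we set $\boldsymbol{\gamma}_h:=(\gamma_h,\gamma_{h+1},\dots,\gamma_{h+L-1})'\in\mathbb{R}^L$. A prime denotes transposition and $\|\cdot\|$ is the Euclidean norm. "Solution" means a maximizer of the problem. In (1a) the scalar $b$ in the quadratic formula is distinct from the vector $\mathbf{b}$. *)

theory Defs
  imports "HOL-Analysis.Analysis"
begin

text \<open>
  The filter length \<open>L\<close> is \<open>CARD('n)\<close>. As a finite index type \<open>'n\<close> carries no order, the
  position of a coordinate is given explicitly by \<open>pos\<close>, intended to be a bijection from
  \<open>UNIV :: 'n set\<close> onto \<open>{..<CARD('n)}\<close>.
\<close>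

definition lag_vec :: "(int \<Rightarrow> real) \<Rightarrow> ('n \<Rightarrow> nat) \<Rightarrow> nat \<Rightarrow> real ^ 'n" where
  "lag_vec \<gamma> pos h = (\<chi> i. \<gamma> (int h + int (pos i)))"

definition feasible :: "'a::real_inner \<Rightarrow> real \<Rightarrow> 'a \<Rightarrow> bool" where
  "feasible g0 \<alpha>0 b \<longleftrightarrow> (g0 \<bullet> b) / norm g0 = \<alpha>0 \<and> b \<bullet> b = 1"

definition is_solution :: "'a::real_inner \<Rightarrow> 'a \<Rightarrow> real \<Rightarrow> 'a \<Rightarrow> bool" where
  "is_solution g0 gh \<alpha>0 b \<longleftrightarrow> is_arg_max (\<lambda>b. gh \<bullet> b) (feasible g0 \<alpha>0) b"

definition quad_a :: "'a::real_inner \<Rightarrow> 'a \<Rightarrow> real" where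
  "quad_a g0 gh = (g0 \<bullet> g0) * ((g0 \<bullet> g0) * (gh \<bullet> gh) / (g0 \<bullet> gh)\<^sup>2 - 1)"

definition quad_b :: "'a::real_inner \<Rightarrow> 'a \<Rightarrow> real \<Rightarrow> real" where
  "quad_b g0 gh \<alpha>0 = 2 * \<alpha>0 * norm g0 * (1 - (g0 \<bullet> g0) * (gh \<bullet> gh) / (g0 \<bullet> gh)\<^sup>2)"

definition quad_c :: "'a::real_inner \<Rightarrow> 'a \<Rightarrow> real \<Rightarrow> real" where
  "quad_c g0 gh \<alpha>0 = \<alpha>0\<^sup>2 * (g0 \<bullet> g0) * (gh \<bullet> gh) / (g0 \<bullet> gh)\<^sup>2 - 1"

definition discr :: "'a::real_inner \<Rightarrow> 'a \<Rightarrow> real \<Rightarrow> real" where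
  "discr g0 gh \<alpha>0 = (quad_b g0 gh \<alpha>0)\<^sup>2 - 4 * quad_a g0 gh * quad_c g0 gh \<alpha>0"

text \<open>In the following, \<open>s \<in> {1, -1}\<close> is the sign chosen for \<open>\<plusminus>\<close>.\<close>

definition lambda2 :: "'a::real_inner \<Rightarrow> 'a \<Rightarrow> real \<Rightarrow> real \<Rightarrow> real" where
  "lambda2 g0 gh \<alpha>0 s =
     (- quad_b g0 gh \<alpha>0 + s * sqrt (discr g0 gh \<alpha>0)) / (2 * quad_a g0 gh)"

definition lambda1 :: "'a::real_inner \<Rightarrow> 'a \<Rightarrow> real \<Rightarrow> real \<Rightarrow> real" where
  "lambda1 g0 gh \<alpha>0 l2 = (\<alpha>0 * norm g0 - l2 * (g0 \<bullet> g0)) / (g0 \<bullet> gh)"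

definition cand :: "'a::real_inner \<Rightarrow> 'a \<Rightarrow> real \<Rightarrow> real \<Rightarrow> 'a" where
  "cand g0 gh \<alpha>0 s =
     lambda1 g0 gh \<alpha>0 (lambda2 g0 gh \<alpha>0 s) *\<^sub>R gh + lambda2 g0 gh \<alpha>0 s *\<^sub>R g0"

definition lambda1_orth :: "'a::real_inner \<Rightarrow> real \<Rightarrow> real \<Rightarrow> real" where
  "lambda1_orth gh \<alpha>0 s = s * sqrt ((1 - \<alpha>0\<^sup>2) / (gh \<bullet> gh))"

definition cand_orth :: "'a::real_inner \<Rightarrow> 'a \<Rightarrow> real \<Rightarrow> real \<Rightarrow> 'a" where
  "cand_orth g0 gh \<alpha>0 s = lambda1_orth gh \<alpha>0 s *\<^sub>R gh + (\<alpha>0 / norm g0) *\<^sub>R g0"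

end

theory Submission
  imports Defs
begin

text \<open>
  Let \<open>w = gh - ((g0 \<bullet> gh) / (g0 \<bullet> g0)) g0\<close> be the component of \<open>gh\<close> orthogonal to \<open>g0\<close>, and let
  \<open>t > 0\<close> satisfy \<open>t\<^sup>2 (w \<bullet> w) = 1 - \<alpha>0\<^sup>2\<close>. For \<open>\<bar>\<alpha>0\<bar> < 1\<close> both
  \<open>b\<^sub>\<plusminus> = \<plusminus> t w + (\<alpha>0 / \<parallel>g0\<parallel>) g0\<close> are feasible, and every feasible \<open>b\<close> satisfies
  \<open>\<parallel>b - b\<^sub>+\<parallel>\<^sup>2 = 2 t (gh \<bullet> b\<^sub>+ - gh \<bullet> b)\<close>, so \<open>b\<^sub>+\<close> is the unique maximizer. The roots of the
  quadratic yield exactly \<open>b\<^sub>+\<close> and \<open>b\<^sub>-\<close>, with the sign of the root depending on that of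
  \<open>g0 \<bullet> gh\<close>. For \<open>\<bar>\<alpha>0\<bar> = 1\<close> the equality case of Cauchy--Schwarz leaves a single feasible point.
\<close>

section \<open>Gram determinant and the two extremal points\<close>

definition gram :: "'a::real_inner \<Rightarrow> 'a \<Rightarrow> real" where
  "gram x y = (x \<bullet> x) * (y \<bullet> y) - (x \<bullet> y)\<^sup>2"

text \<open>Since \<open>w \<bullet> w = gram g0 gh / (g0 \<bullet> g0)\<close>, this is the factor
  \<open>t\<close> on \<open>w\<close>.\<close>

definition radius :: "'a::real_inner \<Rightarrow> 'a \<Rightarrow> real \<Rightarrow> real" where
  "radius g0 gh \<alpha> = sqrt ((1 - \<alpha>\<^sup>2) * (g0 \<bullet> g0) / gram g0 gh)"

text \<open>For \<open>s = 1\<close> and \<open>s = -1\<close> these are the points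
  \<open>b\<^sub>+\<close> and \<open>b\<^sub>-\<close>, with \<open>w\<close> expanded in
  \<open>gh\<close> and \<open>g0\<close> so that the coefficients can be compared with
  \<open>lambda1\<close> and \<open>lambda2\<close>.\<close>

definition extremal :: "'a::real_inner \<Rightarrow> 'a \<Rightarrow> real \<Rightarrow> real \<Rightarrow> 'a" where
  "extremal g0 gh \<alpha> s = (s * radius g0 gh \<alpha>) *\<^sub>R gh +
     (\<alpha> / norm g0 - s * radius g0 gh \<alpha> * (g0 \<bullet> gh) / (g0 \<bullet> g0)) *\<^sub>R g0"

text \<open>The determinant is the product of the squared lengths of \<open>x\<close> and of the
  part of \<open>y\<close> orthogonal to \<open>x\<close>. Distinctness matters because
  \<open>{x, x}\<close> is a singleton, independent whenever \<open>x\<close> is nonzero.\<close>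

lemma gram_pos:
  fixes x y :: "'a::real_inner"
  assumes "x \<noteq> y" "independent {x, y}"
  shows "gram x y > 0"
proof -
  have x: "x \<noteq> 0" using assms(2) dependent_zero by blast
  have ysp: "y \<notin> span {x}"
  proof -
    have "independent (insert y {x})" using assms(2) by (simp add: insert_commute)
    then show ?thesis using assms(1) by (simp add: independent_insert)
  qed
  define w where "w = y - ((x \<bullet> y) / (x \<bullet> x)) *\<^sub>R x"
  have "w \<noteq> 0"
  proof
    assume "w = 0"
    then have "y = ((x \<bullet> y) / (x \<bullet> x)) *\<^sub>R x" by (simp add: w_def)
    then show False using ysp by (metis span_base span_scale singletonI)
  qed
  then have "(x \<bullet> x) * (w \<bullet> w) > 0" using x by simp
  also have "(x \<bullet> x) * (w \<bullet> w) = gram x y"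
    using x by (simp add: w_def gram_def inner_diff_left inner_diff_right inner_commute[of y x]
        power2_eq_square field_simps)
  finally show ?thesis .
qed

lemma nonzero_of_gram_pos: "gram x y > 0 \<Longrightarrow> x \<noteq> 0"
  by (auto simp: gram_def)

lemma radius_pos: "gram g0 gh > 0 \<Longrightarrow> \<bar>\<alpha>\<bar> < 1 \<Longrightarrow> radius g0 gh \<alpha> > 0"
  using nonzero_of_gram_pos[of g0 gh] by (simp add: radius_def abs_square_less_1)

lemma radius_square:
  assumes "gram g0 gh > 0" "\<bar>\<alpha>\<bar> < 1"
  shows "(radius g0 gh \<alpha>)\<^sup>2 * gram g0 gh = (1 - \<alpha>\<^sup>2) * (g0 \<bullet> g0)"
proof -
  have "\<alpha>\<^sup>2 < 1" using assms(2) by (simp add: abs_square_less_1)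
  then show ?thesis using assms(1) by (simp add: radius_def)
qed

lemma inner_extremal_g0:
  assumes "g0 \<noteq> 0"
  shows "g0 \<bullet> extremal g0 gh \<alpha> s = \<alpha> * norm g0"
  using assms by (simp add: extremal_def inner_add_right algebra_simps flip: power2_norm_eq_inner)
    (simp add: power2_eq_square)

lemma inner_extremal:
  assumes "g0 \<noteq> 0"
  shows "gh \<bullet> extremal g0 gh \<alpha> s =
    s * radius g0 gh \<alpha> * gram g0 gh / (g0 \<bullet> g0) + \<alpha> * (g0 \<bullet> gh) / norm g0"
  using assms by (simp add: extremal_def gram_def inner_add_right inner_commute[of gh g0]
      power2_eq_square field_simps)

text \<open>On the hyperplane of the linear constraint, the product with an extremal point is affine
  in the objective; this converts distances into objective gaps. Unit length of \<open>b\<close> is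
  not assumed, so \<open>b\<close> may be an extremal point whose norm is still to be
  computed.\<close>

lemma inner_extremal_feasible:
  assumes "g0 \<noteq> 0" "g0 \<bullet> b = \<alpha> * norm g0"
  shows "extremal g0 gh \<alpha> s \<bullet> b =
    s * radius g0 gh \<alpha> * (gh \<bullet> b - \<alpha> * (g0 \<bullet> gh) / norm g0) + \<alpha>\<^sup>2"
  using assms by (simp add: extremal_def inner_add_left power2_eq_square field_simps
      dot_square_norm)

lemma extremal_norm:
  assumes "gram g0 gh > 0" "\<bar>\<alpha>\<bar> < 1" "s\<^sup>2 = 1"
  shows "extremal g0 gh \<alpha> s \<bullet> extremal g0 gh \<alpha> s = 1"
proof -
  note g0 = nonzero_of_gram_pos[OF assms(1)]
  have "extremal g0 gh \<alpha> s \<bullet> extremal g0 gh \<alpha> s =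
      s\<^sup>2 * ((radius g0 gh \<alpha>)\<^sup>2 * gram g0 gh) / (g0 \<bullet> g0) + \<alpha>\<^sup>2"
    unfolding inner_extremal_feasible[OF g0 inner_extremal_g0[OF g0]] inner_extremal[OF g0]
    by (simp add: power2_eq_square)
  also have "\<dots> = 1"
    using g0 by (simp add: radius_square[OF assms(1,2)] assms(3))
  finally show ?thesis .
qed

section \<open>The feasible set and its maximizers\<close>

lemma feasible_iff:
  assumes "g0 \<noteq> 0"
  shows "feasible g0 \<alpha> b \<longleftrightarrow> g0 \<bullet> b = \<alpha> * norm g0 \<and> b \<bullet> b = 1"
  using assms by (simp add: feasible_def divide_eq_eq)

lemma extremal_gap:
  assumes "gram g0 gh > 0" "\<bar>\<alpha>\<bar> < 1" "feasible g0 \<alpha> b"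
  shows "(norm (b - extremal g0 gh \<alpha> 1))\<^sup>2 =
    2 * radius g0 gh \<alpha> * (gh \<bullet> extremal g0 gh \<alpha> 1 - gh \<bullet> b)"
proof -
  note g0 = nonzero_of_gram_pos[OF assms(1)]
  let ?e = "extremal g0 gh \<alpha> 1"
  have b: "g0 \<bullet> b = \<alpha> * norm g0" "b \<bullet> b = 1"
    using assms(3) by (simp_all add: feasible_iff[OF g0])
  have e: "?e \<bullet> ?e = 1" using extremal_norm[OF assms(1,2), of 1] by simp
  have "(norm (b - ?e))\<^sup>2 = b \<bullet> b + ?e \<bullet> ?e - 2 * (?e \<bullet> b)"
    by (simp add: power2_norm_eq_inner inner_diff_left inner_diff_right inner_commute[of b ?e])
  \<comment> \<open>Trading \<open>b \<bullet> b\<close> for \<open>?e \<bullet> ?e\<close> lets the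
    affine formula apply to both products, so that its constant terms cancel.\<close>
  also have "\<dots> = 2 * (?e \<bullet> ?e) - 2 * (?e \<bullet> b)" using b e by simp
  also have "\<dots> = 2 * radius g0 gh \<alpha> * (gh \<bullet> ?e - gh \<bullet> b)"
    unfolding inner_extremal_feasible[OF g0 inner_extremal_g0[OF g0]]
      inner_extremal_feasible[OF g0 b(1)]
    by (simp add: algebra_simps)
  finally show ?thesis .
qed

lemma is_solution_iff_extremal:
  assumes "gram g0 gh > 0" "\<bar>\<alpha>\<bar> < 1"
  shows "is_solution g0 gh \<alpha> b \<longleftrightarrow> b = extremal g0 gh \<alpha> 1"
proof -
  note g0 = nonzero_of_gram_pos[OF assms(1)]
  let ?e = "extremal g0 gh \<alpha> 1"
  have feas: "feasible g0 \<alpha> ?e"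
    using extremal_norm[OF assms, of 1] by (simp add: feasible_iff[OF g0] inner_extremal_g0[OF g0])
  have less: "gh \<bullet> x < gh \<bullet> ?e" if "feasible g0 \<alpha> x" "x \<noteq> ?e" for x
  proof -
    have "0 < (norm (x - ?e))\<^sup>2" using that by simp
    then show ?thesis
      unfolding extremal_gap[OF assms that(1)] using radius_pos[OF assms]
      by (simp add: zero_less_mult_iff)
  qed
  show ?thesis
    unfolding is_solution_def is_arg_max_def using feas less by (metis less_asym)
qed

lemma is_solution_boundary:
  assumes "g0 \<noteq> 0" "\<bar>\<alpha>\<bar> = 1"
  shows "is_solution g0 gh \<alpha> b \<longleftrightarrow> b = (sgn \<alpha> / norm g0) *\<^sub>R g0"
proof -
  \<comment> \<open>On the boundary \<alpha> is its own sign and its own inverse.\<close>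
  have sgn: "sgn \<alpha> = \<alpha>" and sq: "\<alpha> * \<alpha> = 1" using assms(2) by (auto simp: abs_if split: if_splits)
  let ?e = "(\<alpha> / norm g0) *\<^sub>R g0"
  have ee: "?e \<bullet> ?e = 1"
    using assms(1) sq by (simp add: dot_square_norm power2_eq_square)
  have "feasible g0 \<alpha> x \<longleftrightarrow> x = ?e" for x
  proof
    assume "feasible g0 \<alpha> x"
    then have x: "g0 \<bullet> x = \<alpha> * norm g0" "x \<bullet> x = 1" by (simp_all add: feasible_iff[OF assms(1)])
    \<comment> \<open>Two unit vectors with inner product 1 coincide, so the feasible set is a
      singleton and the objective cannot affect the solution.\<close>
    have "?e \<bullet> x = 1" using assms(1) sq by (simp add: x)
    then have "(x - ?e) \<bullet> (x - ?e) = 0"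
      using ee x(2) by (simp only: inner_diff_left inner_diff_right inner_commute[of x ?e])
    then show "x = ?e" by simp
  next
    assume "x = ?e"
    then show "feasible g0 \<alpha> x"
      using ee assms(1) by (simp add: feasible_iff dot_square_norm power2_eq_square)
  qed
  then show ?thesis unfolding sgn is_solution_def is_arg_max_def by auto
qed

text \<open>The two values differ only in the term carrying \<open>s\<close>, whose coefficient is
  \<open>t (w \<bullet> w) > 0\<close>.\<close>

lemma extremal_mono:
  assumes "gram g0 gh > 0" "\<bar>\<alpha>\<bar> < 1"
  shows "gh \<bullet> extremal g0 gh \<alpha> (- 1) < gh \<bullet> extremal g0 gh \<alpha> 1"
proof -
  note g0 = nonzero_of_gram_pos[OF assms(1)]
  have "radius g0 gh \<alpha> * gram g0 gh / (g0 \<bullet> g0) > 0"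
    using g0 radius_pos[OF assms] assms(1) by simp
  then show ?thesis unfolding inner_extremal[OF g0] by simp
qed

section \<open>Roots of the quadratic\<close>

lemma quad_a_eq:
  assumes "g0 \<bullet> gh \<noteq> 0"
  shows "quad_a g0 gh = (g0 \<bullet> g0) * gram g0 gh / (g0 \<bullet> gh)\<^sup>2"
  using assms by (simp add: quad_a_def gram_def field_simps)

lemma quad_b_eq:
  assumes "g0 \<bullet> gh \<noteq> 0"
  shows "quad_b g0 gh \<alpha> = - 2 * \<alpha> * norm g0 * gram g0 gh / (g0 \<bullet> gh)\<^sup>2"
  using assms by (simp add: quad_b_def gram_def field_simps)

lemma discr_eq:
  assumes "gram g0 gh > 0" "\<bar>\<alpha>\<bar> < 1" "g0 \<bullet> gh \<noteq> 0"
  shows "discr g0 gh \<alpha> = (2 * radius g0 gh \<alpha> * gram g0 gh / (g0 \<bullet> gh))\<^sup>2"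
proof -
  define p q r D where "p = g0 \<bullet> g0" and "q = gh \<bullet> gh" and "r = g0 \<bullet> gh" and "D = gram g0 gh"
  have r: "r \<noteq> 0" and D: "D = p * q - r\<^sup>2" using assms(3) by (simp_all add: r_def D_def gram_def p_def q_def)
  have n: "(norm g0)\<^sup>2 = p" by (simp add: p_def power2_norm_eq_inner)
  have "discr g0 gh \<alpha> = (- 2 * \<alpha> * norm g0 * D / r\<^sup>2)\<^sup>2 - 4 * (p * D / r\<^sup>2) * (\<alpha>\<^sup>2 * p * q / r\<^sup>2 - 1)"
    using assms(3) by (simp add: discr_def quad_a_eq quad_b_eq quad_c_def p_def q_def r_def D_def)
  also have "\<dots> = 4 * \<alpha>\<^sup>2 * p * D\<^sup>2 / r^4 - 4 * (p * D / r\<^sup>2) * (\<alpha>\<^sup>2 * p * q / r\<^sup>2 - 1)"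
    using n by (simp add: power_mult_distrib power_divide)
  also have "\<dots> = 4 * p * D * (\<alpha>\<^sup>2 * D - \<alpha>\<^sup>2 * p * q + r\<^sup>2) / r^4"
    using r by (simp add: field_simps power2_eq_square power4_eq_xxxx)
  \<comment> \<open>Substituting \<open>D = p * q - r\<^sup>2\<close> collapses the bracket to
    \<open>(1 - \<alpha>\<^sup>2) * r\<^sup>2\<close>; \<open>radius_square\<close> then supplies a
    second factor \<open>D\<close>, making the discriminant a perfect square.\<close>
  also have "\<dots> = 4 * D * ((1 - \<alpha>\<^sup>2) * p) / r\<^sup>2"
    using r by (simp add: D field_simps power2_eq_square power4_eq_xxxx)
  also have "(1 - \<alpha>\<^sup>2) * p = (radius g0 gh \<alpha>)\<^sup>2 * D"
    using radius_square[OF assms(1,2)] by (simp add: p_def D_def)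
  also have "4 * D * ((radius g0 gh \<alpha>)\<^sup>2 * D) / r\<^sup>2 = (2 * radius g0 gh \<alpha> * D / r)\<^sup>2"
    by (simp add: power2_eq_square)
  finally show ?thesis by (simp add: r_def D_def)
qed

text \<open>The square root of the discriminant carries \<open>\<bar>g0 \<bullet> gh\<bar>\<close>, hence the sign twist.\<close>

lemma lambda2_eq:
  assumes "gram g0 gh > 0" "\<bar>\<alpha>\<bar> < 1" "g0 \<bullet> gh \<noteq> 0"
  shows "lambda2 g0 gh \<alpha> (- s * sgn (g0 \<bullet> gh)) =
    \<alpha> / norm g0 - s * radius g0 gh \<alpha> * (g0 \<bullet> gh) / (g0 \<bullet> g0)"
proof -
  note g0 = nonzero_of_gram_pos[OF assms(1)]
  define p n r D t where "p = g0 \<bullet> g0" and "n = norm g0" and "r = g0 \<bullet> gh"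
    and "D = gram g0 gh" and "t = radius g0 gh \<alpha>"
  have pos: "n > 0" "D > 0" "t > 0" "r \<noteq> 0" "p = n * n"
    using g0 assms radius_pos[OF assms(1,2)]
    by (simp_all add: n_def D_def t_def r_def p_def dot_square_norm power2_eq_square)
  have "sqrt (discr g0 gh \<alpha>) = 2 * t * D / \<bar>r\<bar>"
    using pos by (simp add: discr_eq[OF assms] abs_mult flip: t_def D_def r_def)
  then have "lambda2 g0 gh \<alpha> (- s * sgn r) =
      (2 * \<alpha> * n * D / r\<^sup>2 - s * sgn r * (2 * t * D / \<bar>r\<bar>)) / (2 * (p * D / r\<^sup>2))"
    using assms(3) by (simp add: lambda2_def quad_a_eq quad_b_eq p_def r_def n_def D_def)
  also have "sgn r * (2 * t * D / \<bar>r\<bar>) = 2 * t * D / r"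
    using pos by (simp add: sgn_if)
  then have "s * sgn r * (2 * t * D / \<bar>r\<bar>) = s * (2 * t * D / r)"
    by (simp only: mult.assoc)
  also have "(2 * \<alpha> * n * D / r\<^sup>2 - s * (2 * t * D / r)) / (2 * (p * D / r\<^sup>2)) =
      \<alpha> / n - s * t * r / p"
    using pos by (simp add: field_simps power2_eq_square)
  finally show ?thesis by (simp add: p_def r_def n_def t_def)
qed

text \<open>\<open>lambda1\<close> solves the linear constraint for the coefficient of
  \<open>gh\<close>, so it recovers \<open>t\<close> from the coefficient of \<open>g0\<close> in
  \<open>t w + (\<alpha> / norm g0) g0\<close>.\<close>

lemma lambda1_eq:
  assumes "g0 \<noteq> 0" "g0 \<bullet> gh \<noteq> 0"
  shows "lambda1 g0 gh \<alpha> (\<alpha> / norm g0 - t * (g0 \<bullet> gh) / (g0 \<bullet> g0)) = t"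
  using assms by (simp add: lambda1_def dot_square_norm power2_eq_square field_simps)

lemma cand_eq_extremal:
  assumes "gram g0 gh > 0" "\<bar>\<alpha>\<bar> < 1" "g0 \<bullet> gh \<noteq> 0"
  shows "cand g0 gh \<alpha> (- s * sgn (g0 \<bullet> gh)) = extremal g0 gh \<alpha> s"
  unfolding cand_def lambda2_eq[OF assms]
    lambda1_eq[OF nonzero_of_gram_pos[OF assms(1)] assms(3), of _ "s * radius g0 gh \<alpha>"]
  by (simp add: extremal_def)

section \<open>The orthogonal case\<close>

lemma lambda1_orth_eq:
  assumes "g0 \<noteq> 0" "g0 \<bullet> gh = 0"
  shows "lambda1_orth gh \<alpha> s = s * radius g0 gh \<alpha>"
  \<comment> \<open>Orthogonality reduces \<open>gram g0 gh\<close> to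
    \<open>(g0 \<bullet> g0) * (gh \<bullet> gh)\<close>, and \<open>g0 \<bullet> g0\<close> cancels
    under the root.\<close>
  using assms by (simp add: lambda1_orth_def radius_def gram_def)

lemma cand_orth_eq_extremal:
  assumes "g0 \<noteq> 0" "g0 \<bullet> gh = 0"
  shows "cand_orth g0 gh \<alpha> s = extremal g0 gh \<alpha> s"
  using assms by (simp add: cand_orth_def extremal_def lambda1_orth_eq)

theorem theorem1:
  fixes \<gamma> :: "int \<Rightarrow> real"
    and pos :: "'n::finite \<Rightarrow> nat"
    and h :: nat
    and \<alpha>0 :: real
    and g0 gh :: "real ^ 'n"
  assumes "(\<lambda>k. (\<gamma> k)\<^sup>2) summable_on UNIV"
    and "bij_betw pos (UNIV :: 'n set) {..<CARD('n)}"
    and "h \<ge> 1"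
    and "g0 = lag_vec \<gamma> pos 0"
    and "gh = lag_vec \<gamma> pos h"
    and "g0 \<noteq> gh" and "independent {g0, gh}"
  shows "(\<bar>\<alpha>0\<bar> < 1 \<longrightarrow>
            (\<exists>b l1 l2.
               (\<forall>b'. is_solution g0 gh \<alpha>0 b' \<longleftrightarrow> b' = b) \<and>
               b \<in> span {g0, gh} \<and>
               b = l1 *\<^sub>R gh + l2 *\<^sub>R g0 \<and>
               (g0 \<bullet> gh \<noteq> 0 \<longrightarrow>
                  quad_a g0 gh \<noteq> 0 \<and> discr g0 gh \<alpha>0 \<ge> 0 \<and>
                  l1 = lambda1 g0 gh \<alpha>0 l2 \<and>
                  (\<exists>s\<in>{1, -1}. l2 = lambda2 g0 gh \<alpha>0 s \<and>
                     gh \<bullet> cand g0 gh \<alpha>0 s > gh \<bullet> cand g0 gh \<alpha>0 (- s))) \<and>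
               (g0 \<bullet> gh = 0 \<longrightarrow>
                  l2 = \<alpha>0 / norm g0 \<and>
                  (\<exists>s\<in>{1, -1}. l1 = lambda1_orth gh \<alpha>0 s \<and>
                     gh \<bullet> cand_orth g0 gh \<alpha>0 s > gh \<bullet> cand_orth g0 gh \<alpha>0 (- s))))) \<and>
         (\<bar>\<alpha>0\<bar> = 1 \<longrightarrow>
            (\<forall>b. is_solution g0 gh \<alpha>0 b \<longleftrightarrow> b = (sgn \<alpha>0 / norm g0) *\<^sub>R g0))"
proof (intro conjI impI allI)
  have G: "gram g0 gh > 0" using assms(6,7) by (rule gram_pos)
  note g0 = nonzero_of_gram_pos[OF G]
  show "is_solution g0 gh \<alpha>0 b \<longleftrightarrow> b = (sgn \<alpha>0 / norm g0) *\<^sub>R g0" if "\<bar>\<alpha>0\<bar> = 1" for b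
    using g0 that by (rule is_solution_boundary)
  assume \<alpha>: "\<bar>\<alpha>0\<bar> < 1"
  define e where "e = extremal g0 gh \<alpha>0 1"
  define l1 where "l1 = radius g0 gh \<alpha>0"
  define l2 where "l2 = \<alpha>0 / norm g0 - radius g0 gh \<alpha>0 * (g0 \<bullet> gh) / (g0 \<bullet> g0)"
  have e: "e = l1 *\<^sub>R gh + l2 *\<^sub>R g0" by (simp add: e_def l1_def l2_def extremal_def)
  have span: "e \<in> span {g0, gh}"
    unfolding e by (intro span_add span_scale span_base) auto
  have generic: "quad_a g0 gh \<noteq> 0 \<and> discr g0 gh \<alpha>0 \<ge> 0 \<and> l1 = lambda1 g0 gh \<alpha>0 l2 \<and>
      (\<exists>s\<in>{1, -1}. l2 = lambda2 g0 gh \<alpha>0 s \<and>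
         gh \<bullet> cand g0 gh \<alpha>0 s > gh \<bullet> cand g0 gh \<alpha>0 (- s))" if r: "g0 \<bullet> gh \<noteq> 0"
  proof (intro conjI)
    show "quad_a g0 gh \<noteq> 0" using G g0 r by (simp add: quad_a_eq)
    show "discr g0 gh \<alpha>0 \<ge> 0" by (simp add: discr_eq[OF G \<alpha> r])
    show "l1 = lambda1 g0 gh \<alpha>0 l2" by (simp add: l1_def l2_def lambda1_eq[OF g0 r])
    show "\<exists>s\<in>{1, -1}. l2 = lambda2 g0 gh \<alpha>0 s \<and>
         gh \<bullet> cand g0 gh \<alpha>0 s > gh \<bullet> cand g0 gh \<alpha>0 (- s)"
    proof (intro bexI conjI)
      \<comment> \<open>The root giving \<open>b\<^sub>+\<close> is the minus root if
        \<open>g0 \<bullet> gh > 0\<close> and the plus root otherwise; the opposite sign gives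
        \<open>b\<^sub>-\<close>.\<close>
      let ?s = "- sgn (g0 \<bullet> gh)"
      show "l2 = lambda2 g0 gh \<alpha>0 ?s" using lambda2_eq[OF G \<alpha> r, of 1] by (simp add: l2_def)
      show "gh \<bullet> cand g0 gh \<alpha>0 ?s > gh \<bullet> cand g0 gh \<alpha>0 (- ?s)"
        using extremal_mono[OF G \<alpha>] cand_eq_extremal[OF G \<alpha> r, of 1]
          cand_eq_extremal[OF G \<alpha> r, of "- 1"] by simp
      show "?s \<in> {1, -1}" using r by (auto simp: sgn_if)
    qed
  qed
  \<comment> \<open>There is no sign twist here: \<open>s = 1\<close> gives \<open>b\<^sub>+\<close>
    directly.\<close>
  have orth: "l2 = \<alpha>0 / norm g0 \<and> (\<exists>s\<in>{1, -1}. l1 = lambda1_orth gh \<alpha>0 s \<and>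
       gh \<bullet> cand_orth g0 gh \<alpha>0 s > gh \<bullet> cand_orth g0 gh \<alpha>0 (- s))" if r: "g0 \<bullet> gh = 0"
    using extremal_mono[OF G \<alpha>] r
    by (simp add: l1_def l2_def lambda1_orth_eq[OF g0 r] cand_orth_eq_extremal[OF g0 r])
  have "\<forall>b'. is_solution g0 gh \<alpha>0 b' \<longleftrightarrow> b' = e"
    unfolding e_def using is_solution_iff_extremal[OF G \<alpha>] by blast
  then show "\<exists>b l1 l2.
      (\<forall>b'. is_solution g0 gh \<alpha>0 b' \<longleftrightarrow> b' = b) \<and>
      b \<in> span {g0, gh} \<and>
      b = l1 *\<^sub>R gh + l2 *\<^sub>R g0 \<and>
      (g0 \<bullet> gh \<noteq> 0 \<longrightarrow>
         quad_a g0 gh \<noteq> 0 \<and> discr g0 gh \<alpha>0 \<ge> 0 \<and>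
         l1 = lambda1 g0 gh \<alpha>0 l2 \<and>
         (\<exists>s\<in>{1, -1}. l2 = lambda2 g0 gh \<alpha>0 s \<and>
            gh \<bullet> cand g0 gh \<alpha>0 s > gh \<bullet> cand g0 gh \<alpha>0 (- s))) \<and>
      (g0 \<bullet> gh = 0 \<longrightarrow>
         l2 = \<alpha>0 / norm g0 \<and>
         (\<exists>s\<in>{1, -1}. l1 = lambda1_orth gh \<alpha>0 s \<and>
            gh \<bullet> cand_orth g0 gh \<alpha>0 s > gh \<bullet> cand_orth g0 gh \<alpha>0 (- s)))"
    using span e generic orth by blast
qed

end
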